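(* A graph $G$ is $4$-colorable if and only if $T_2(G,+)$ admits a homomorphism to $C_{-4}$.
   Context: All graphs are finite and simple. A signed graph $(G,\sigma)$ is a graph $G$ with a signature $\sigma:E(G)\to\{+,-\}$; $(G,+)$ denotes $G$ with all edges positive. Switching at a set $X\subseteq V(G)$ means flipping the signs of all edges with exactly one end in $X$; two signatures on $G$ are equivalent if one is obtained from the other by switching. A homomorphism $(G,\sigma)\to(H,\pi)$ exists if and only if there are a signature $\sigma'$ equivalent to $\sigma$ and a map $f:V(G)\to V(H)$ such that for every edge $uv$ of $G$, $f(u)f(v)$ is an edge of $H$ with $\pi(f(u)f(v))=\sigma'(uv)$. $C_{-4}$ is the signed 4-cycle on $u_1,u_2,u_3,u_4$ with positive edges $u_1u_2,u_2u_3,u_3u_4$ and negative edge $u_4u_1$. For a signed graph $(G,\sigma)$, $T_2(G,\sigma)$ is the signed graph obtained by replacing each edge $uv$ of $G$ by a $u$–$v$ path of length $2$ (with a new internal vertex) whose two edges are given signs with product $-\sigma(uv)$ (well defined up to switching). Thus $T_2(G,+)$ is obtained from $G$ by replacing each edge with a path of length 2 having exactly one negative edge. *)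

theory Defs
  imports Main "HOL-Library.FuncSet"
begin

record 'a ugraph =
  verts :: "'a set"
  edges :: "'a set set"

definition simple_graph :: "'a ugraph \<Rightarrow> bool" where
  "simple_graph G \<longleftrightarrow> finite (verts G) \<and> (\<forall>e\<in>edges G. e \<subseteq> verts G \<and> card e = 2)"

definition colorable :: "nat \<Rightarrow> 'a ugraph \<Rightarrow> bool" where
  "colorable k G \<longleftrightarrow>
     (\<exists>c. c \<in> verts G \<rightarrow> {..<k} \<and> (\<forall>u v. {u, v} \<in> edges G \<longrightarrow> c u \<noteq> c v))"

text \<open>The signs are the integers 1 and -1. Only the values of a signature on the edges of the
  underlying graph are meaningful.\<close>

type_synonym 'a signed_graph = "'a ugraph \<times> ('a set \<Rightarrow> int)"

definition is_signature :: "'a ugraph \<Rightarrow> ('a set \<Rightarrow> int) \<Rightarrow> bool" where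
  "is_signature G \<sigma> \<longleftrightarrow> \<sigma> \<in> edges G \<rightarrow> {1, -1}"

definition signed_graph :: "'a signed_graph \<Rightarrow> bool" where
  "signed_graph = (\<lambda>(G, \<sigma>). simple_graph G \<and> is_signature G \<sigma>)"

definition all_positive :: "'a set \<Rightarrow> int" where
  "all_positive = (\<lambda>e. 1)"

definition switch :: "'a set \<Rightarrow> ('a set \<Rightarrow> int) \<Rightarrow> 'a set \<Rightarrow> int" where
  "switch X \<sigma> e = (if card (e \<inter> X) = 1 then - \<sigma> e else \<sigma> e)"

definition switching_equivalent ::
    "'a ugraph \<Rightarrow> ('a set \<Rightarrow> int) \<Rightarrow> ('a set \<Rightarrow> int) \<Rightarrow> bool" where
  "switching_equivalent G \<sigma> \<sigma>' \<longleftrightarrow>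
     (\<exists>X\<subseteq>verts G. \<forall>e\<in>edges G. \<sigma>' e = switch X \<sigma> e)"

definition admits_hom :: "'a signed_graph \<Rightarrow> 'b signed_graph \<Rightarrow> bool" where
  "admits_hom = (\<lambda>(G, \<sigma>) (H, \<pi>).
     \<exists>\<sigma>' f. switching_equivalent G \<sigma> \<sigma>' \<and> f \<in> verts G \<rightarrow> verts H \<and>
       (\<forall>u v. {u, v} \<in> edges G \<longrightarrow>
          {f u, f v} \<in> edges H \<and> \<pi> {f u, f v} = \<sigma>' {u, v}))"

definition C_minus_4 :: "nat signed_graph" where
  "C_minus_4 =
     (\<lparr>verts = {1, 2, 3, 4}, edges = {{1, 2}, {2, 3}, {3, 4}, {4, 1}}\<rparr>,
      \<lambda>e. if e = {4, 1} then -1 else 1)"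

text \<open>An original vertex \<open>v\<close> becomes \<open>Inl v\<close>; the new internal vertex on the path
  replacing the edge \<open>e\<close> is \<open>Inr e\<close>.\<close>

definition subdivision :: "'a ugraph \<Rightarrow> ('a + 'a set) ugraph" where
  "subdivision G =
     \<lparr>verts = Inl ` verts G \<union> Inr ` edges G,
      edges = {{Inl v, Inr e} | v e. e \<in> edges G \<and> v \<in> e}\<rparr>"

text \<open>The signed graph \<open>T\<^sub>2(G, \<sigma>)\<close> is determined only up to switching, so it is
  rendered as a relation that holds for every admissible choice of signs.\<close>

definition is_T2 :: "'a signed_graph \<Rightarrow> ('a + 'a set) signed_graph \<Rightarrow> bool" where
  "is_T2 = (\<lambda>(G, \<sigma>) (H, \<tau>).
     H = subdivision G \<and> is_signature H \<tau> \<and>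
     (\<forall>u v. {u, v} \<in> edges G \<longrightarrow>
        \<tau> {Inl u, Inr {u, v}} * \<tau> {Inr {u, v}, Inl v} = - \<sigma> {u, v}))"

lemma is_T2_exists:
  assumes "signed_graph (G, \<sigma>)"
  shows "\<exists>T. is_T2 (G, \<sigma>) T"
proof -
  define p where "p e = (SOME y. y \<in> e)" for e :: "'a set"
  define \<tau> where "\<tau> d = (if \<exists>e. d = {Inl (p e), Inr e}
    then - \<sigma> (THE e. Inr e \<in> d) else 1)" for d :: "('a + 'a set) set"
  have the: "(THE e'. Inr e' \<in> {Inl v, Inr e}) = e" for v :: 'a and e :: "'a set"
    by (rule the_equality) auto
  have \<tau>: "\<tau> {Inl v, Inr e} = (if v = p e then - \<sigma> e else 1)" for v e
    unfolding \<tau>_def the by (auto simp: doubleton_eq_iff)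
  have card2: "card e = 2" if "e \<in> edges G" for e
    using assms that by (auto simp: signed_graph_def simple_graph_def)
  have sgn: "\<sigma> e = 1 \<or> \<sigma> e = -1" if "e \<in> edges G" for e
    using assms that by (auto simp: signed_graph_def is_signature_def)
  have "is_signature (subdivision G) \<tau>"
    unfolding is_signature_def
  proof (rule Pi_I)
    fix d assume "d \<in> edges (subdivision G)"
    then obtain v e where d: "d = {Inl v, Inr e}" and "e \<in> edges G"
      by (auto simp: subdivision_def)
    from sgn[OF this(2)] show "\<tau> d \<in> {1, -1}" by (auto simp: d \<tau>)
  qed
  moreover have "\<tau> {Inl u, Inr {u, v}} * \<tau> {Inr {u, v}, Inl v} = - \<sigma> {u, v}"
    if "{u, v} \<in> edges G" for u v
  proof -
    have "u \<noteq> v" using card2[OF that] by auto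
    moreover have "p {u, v} \<in> {u, v}" unfolding p_def by (rule someI) blast
    ultimately show ?thesis by (auto simp: \<tau> insert_commute[of "Inr _"])
  qed
  ultimately show ?thesis by (auto simp: is_T2_def)
qed

end

theory Submission
  imports Defs
begin

text \<open>Record for every vertex \<open>x\<close> its image \<open>f x\<close> and the sign \<open>s x\<close> that says whether \<open>x\<close> is switched.
  If the two-edge path replacing an edge \<open>uv\<close> is mapped to a walk in \<open>C\<^sub>-\<^sub>4\<close>, the sign of that walk
  is \<open>- s u * s v\<close>. Walks of length 2 in \<open>C\<^sub>-\<^sub>4\<close> join vertices of the same parity: from a vertex to
  itself all are positive, while between opposite vertices both signs occur. So the only restriction
  is that \<open>f u\<close> and \<open>f v\<close> have the same parity, and that \<open>s u \<noteq> s v\<close> if \<open>f u = f v\<close>. The position of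
  the image within its parity class together with the sign therefore amounts to a proper
  4-colouring.\<close>

text \<open>Describing a switching set by signs on vertices makes switching multiplicative: an edge
  sign gets multiplied by the signs of its two ends.\<close>

definition switch_sign :: "'a set \<Rightarrow> 'a \<Rightarrow> int" where
  "switch_sign X x = (if x \<in> X then -1 else 1)"

lemma switch_doubleton:
  assumes "x \<noteq> y"
  shows "switch X \<sigma> {x, y} = switch_sign X x * switch_sign X y * \<sigma> {x, y}"
  using assms by (auto simp: switch_def switch_sign_def Int_insert_left)

text \<open>The 4-cycle is bipartite, its classes being the odd and the even vertices.\<close>

lemma C_minus_4_two_walk:
  assumes "{i, j} \<in> edges (fst C_minus_4)" "{j, k} \<in> edges (fst C_minus_4)"
  shows "even i \<longleftrightarrow> even k"
  using assms by (auto simp: C_minus_4_def doubleton_eq_iff)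

text \<open>Between 1 and 3 the walk through 2 is positive, while the one through 4 uses the only
  negative edge. A closed walk traverses one edge twice, hence is positive.\<close>

lemma C_minus_4_two_walk_exists:
  assumes "i \<in> {1, 3}" "k \<in> {1, 3}" "p \<in> {1, -1}" "i = k \<Longrightarrow> p = 1"
  shows "\<exists>j\<in>{2, 4}. snd C_minus_4 {i, j} * snd C_minus_4 {k, j} = p"
  using assms by (auto simp: C_minus_4_def doubleton_eq_iff)

text \<open>The underlying 4-cycle is complete bipartite.\<close>

lemma C_minus_4_odd_even_edge:
  assumes "i \<in> {1, 3}" "j \<in> {2, 4}"
  shows "{i, j} \<in> edges (fst C_minus_4)" "snd C_minus_4 {i, j} \<in> {1, -1}"
  using assms by (auto simp: C_minus_4_def doubleton_eq_iff)

lemma simple_graph_edgeE: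
  assumes "simple_graph G" "e \<in> edges G"
  obtains u v where "e = {u, v}" "u \<noteq> v" "u \<in> verts G" "v \<in> verts G"
proof -
  have "card e = 2" "e \<subseteq> verts G"
    using assms by (auto simp: simple_graph_def)
  then show thesis
    using that by (auto simp: card_2_iff)
qed

lemma hom_C_minus_4_if_colorable:
  assumes G: "simple_graph G" and T: "is_T2 (G, all_positive) (H, \<tau>)" and "colorable 4 G"
  shows "admits_hom (H, \<tau>) C_minus_4"
proof -
  obtain c where c: "c \<in> verts G \<rightarrow> {..<4::nat}"
    and proper: "\<And>u v. {u, v} \<in> edges G \<Longrightarrow> c u \<noteq> c v"
    using \<open>colorable 4 G\<close> unfolding colorable_def by blast
  have H: "H = subdivision G" and sig: "is_signature H \<tau>"
    and prod: "\<And>u v. {u, v} \<in> edges G \<Longrightarrow> \<tau> {Inl u, Inr {u, v}} * \<tau> {Inl v, Inr {u, v}} = -1"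
    using T by (auto simp: is_T2_def all_positive_def insert_commute)
  define \<pi> where "\<pi> = snd C_minus_4"
  \<comment> \<open>Original vertices all go to the odd class: the upper bit of the colour selects 1
    or 3, the lower bit decides about switching. This leaves 2 and 4 for the subdivision
    vertices.\<close>
  define a where "a v = (if c v < 2 then 1 else 3 :: nat)" for v
  define s where "s v = (if even (c v) then 1 else -1 :: int)" for v
  have a: "a v \<in> {1, 3}" for v
    by (simp add: a_def)
  have s: "s v \<in> {1, -1}" for v
    by (simp add: s_def)
  have \<tau>: "\<tau> {Inl v, Inr e} \<in> {1, -1}" if "e \<in> edges G" "v \<in> e" for v e
    using sig that by (auto simp: is_signature_def H subdivision_def)
  \<comment> \<open>Here \<open>j\<close> is the future image of the subdivision vertex
    \<open>Inr e\<close> and \<open>t\<close> its switching sign.\<close>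
  have "\<exists>j t. j \<in> {2, 4} \<and> t \<in> {1, -1} \<and> (\<forall>v\<in>e. \<pi> {a v, j} = s v * t * \<tau> {Inl v, Inr e})"
    if e: "e \<in> edges G" for e
  proof -
    obtain u v where uv: "e = {u, v}" "u \<noteq> v" "u \<in> verts G" "v \<in> verts G"
      using G e by (rule simple_graph_edgeE)
    have "c w \<in> {0, 1, 2, 3}" if "w \<in> verts G" for w
      using Pi_mem[OF c that] by auto
    from this[OF uv(3)] this[OF uv(4)] have "s u \<noteq> s v" if "a u = a v"
      using proper[of u v] e uv(1) that by (auto simp: a_def s_def)
    then have "- (s u * s v) = 1" if "a u = a v"
      using that s[of u] s[of v] by auto
    moreover have "- (s u * s v) \<in> {1, -1}"
      using s[of u] s[of v] by auto
    ultimately obtain j where j: "j \<in> {2, 4}" "\<pi> {a u, j} * \<pi> {a v, j} = - (s u * s v)"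
      using C_minus_4_two_walk_exists[OF a a] unfolding \<pi>_def by metis
    \<comment> \<open>This choice makes the sign right on the edge at \<open>u\<close>. The edge at
      \<open>v\<close> then follows, because the two \<open>\<tau>\<close> signs have product -1 and
      the walk through \<open>j\<close> has sign \<open>- (s u * s v)\<close>.\<close>
    define t where "t = \<pi> {a u, j} * s u * \<tau> {Inl u, Inr e}"
    have signs: "\<pi> {a u, j} \<in> {1, -1}" "\<pi> {a v, j} \<in> {1, -1}"
      using C_minus_4_odd_even_edge(2)[OF a j(1)] by (simp_all add: \<pi>_def)
    have \<tau>uv: "\<tau> {Inl u, Inr e} \<in> {1, -1}" "\<tau> {Inl v, Inr e} \<in> {1, -1}"
      "\<tau> {Inl u, Inr e} * \<tau> {Inl v, Inr e} = -1"
      using \<tau>[OF e] prod[of u v] e uv by auto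
    have "t \<in> {1, -1}" "\<pi> {a u, j} = s u * t * \<tau> {Inl u, Inr e}"
      "\<pi> {a v, j} = s v * t * \<tau> {Inl v, Inr e}"
      using signs \<tau>uv j(2) s[of u] s[of v] by (auto simp: t_def)
    with j(1) uv(1) show ?thesis
      by blast
  qed
  then obtain b t where b: "\<And>e. e \<in> edges G \<Longrightarrow> b e \<in> {2, 4}"
    and t: "\<And>e. e \<in> edges G \<Longrightarrow> t e \<in> {1, -1 :: int}"
    and bt: "\<And>e v. e \<in> edges G \<Longrightarrow> v \<in> e \<Longrightarrow> \<pi> {a v, b e} = s v * t e * \<tau> {Inl v, Inr e}"
    by metis
  define X where "X = Inl ` {v \<in> verts G. s v = -1} \<union> Inr ` {e \<in> edges G. t e = -1}"
  define f where "f = case_sum a b"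
  have "X \<subseteq> verts H"
    by (auto simp: X_def H subdivision_def)
  then have "switching_equivalent H \<tau> (switch X \<tau>)"
    unfolding switching_equivalent_def by blast
  moreover have "f \<in> verts H \<rightarrow> verts (fst C_minus_4)"
    using a b by (fastforce simp: f_def H subdivision_def C_minus_4_def)
  moreover have "{f x, f y} \<in> edges (fst C_minus_4) \<and> \<pi> {f x, f y} = switch X \<tau> {x, y}"
    if "{x, y} \<in> edges H" for x y
  proof -
    obtain v e where xy: "{x, y} = {Inl v, Inr e}" and e: "e \<in> edges G" "v \<in> e"
      using \<open>{x, y} \<in> edges H\<close> by (auto simp: H subdivision_def)
    have "v \<in> verts G"
      using G e by (auto simp: simple_graph_def)
    then have "switch_sign X (Inl v) = s v" "switch_sign X (Inr e) = t e"
      using s[of v] t[of e] e by (auto simp: switch_sign_def X_def)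
    then have "\<pi> {a v, b e} = switch X \<tau> {x, y}"
      using bt[OF e] by (simp add: xy switch_doubleton)
    moreover have "{f x, f y} = {a v, b e}"
      using xy by (auto simp: doubleton_eq_iff f_def)
    ultimately show ?thesis
      using C_minus_4_odd_even_edge(1)[OF a b] e by simp
  qed
  ultimately show ?thesis
    unfolding admits_hom_def \<pi>_def by (auto simp: case_prod_unfold)
qed

lemma colorable_if_hom_C_minus_4:
  assumes G: "simple_graph G" and T: "is_T2 (G, all_positive) (H, \<tau>)"
    and hom: "admits_hom (H, \<tau>) C_minus_4"
  shows "colorable 4 G"
proof -
  have H: "H = subdivision G"
    and prod: "\<And>u v. {u, v} \<in> edges G \<Longrightarrow> \<tau> {Inl u, Inr {u, v}} * \<tau> {Inl v, Inr {u, v}} = -1"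
    using T by (auto simp: is_T2_def all_positive_def insert_commute)
  define \<pi> where "\<pi> = snd C_minus_4"
  obtain \<sigma> f where equiv: "switching_equivalent H \<tau> \<sigma>"
    and f: "f \<in> verts H \<rightarrow> verts (fst C_minus_4)"
    and f_edge: "\<And>x y. {x, y} \<in> edges H \<Longrightarrow>
      {f x, f y} \<in> edges (fst C_minus_4) \<and> \<pi> {f x, f y} = \<sigma> {x, y}"
    using hom unfolding admits_hom_def \<pi>_def by (auto simp: case_prod_unfold)
  obtain X where X: "\<And>e. e \<in> edges H \<Longrightarrow> \<sigma> e = switch X \<tau> e"
    using equiv unfolding switching_equivalent_def by blast
  define s where "s = switch_sign X"
  \<comment> \<open>The threshold separates 1 from 3 and 2 from 4. Parity is left out of the colour
    because it agrees at the two ends of each edge of \<open>G\<close>.\<close>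
  define c :: "'a \<Rightarrow> nat" where
    "c v = (if f (Inl v) \<le> 2 then 0 else 2) + (if s (Inl v) = 1 then 0 else 1)" for v
  have "c u \<noteq> c v" if e: "{u, v} \<in> edges G" for u v
  proof
    assume "c u = c v"
    let ?e = "Inr {u, v}"
    have verts: "u \<in> verts G" "v \<in> verts G"
      using G e by (auto simp: simple_graph_def)
    have edges: "{Inl u, ?e} \<in> edges H" "{Inl v, ?e} \<in> edges H"
      using e by (auto simp: H subdivision_def)
    have s: "s x \<in> {1, -1}" for x
      by (simp add: s_def switch_sign_def)
    have f_range: "f (Inl w) \<in> {1, 2, 3, 4}" if "w \<in> verts G" for w
      using Pi_mem[OF f, of "Inl w"] that by (simp add: H subdivision_def C_minus_4_def)
    have "even (f (Inl u)) \<longleftrightarrow> even (f (Inl v))"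
      using C_minus_4_two_walk[of "f (Inl u)" "f ?e" "f (Inl v)"]
        f_edge[OF edges(1)] f_edge[OF edges(2)]
      by (simp add: insert_commute)
    then have "f (Inl u) = f (Inl v)"
      using \<open>c u = c v\<close> f_range[OF verts(1)] f_range[OF verts(2)]
      by (auto simp: c_def split: if_splits)
    moreover have "s (Inl u) = s (Inl v)"
      using \<open>c u = c v\<close> s[of "Inl u"] s[of "Inl v"] by (auto simp: c_def split: if_splits)
    moreover have "\<pi> {f (Inl u), f ?e} = s (Inl u) * s ?e * \<tau> {Inl u, ?e}"
      "\<pi> {f (Inl v), f ?e} = s (Inl v) * s ?e * \<tau> {Inl v, ?e}"
      using f_edge X edges by (simp_all add: switch_doubleton s_def)
    \<comment> \<open>Both halves of the path land on the same edge and their ends carry the same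
      switching signs. Equal \<open>\<tau>\<close> values would make the product in
      \<open>prod\<close> a square, but it is -1.\<close>
    ultimately have "\<tau> {Inl u, ?e} = \<tau> {Inl v, ?e}"
      using s[of "Inl u"] s[of ?e] by auto
    then show False
      using prod[OF e] zero_le_square[of "\<tau> {Inl v, ?e}"] by simp
  qed
  moreover have "c \<in> verts G \<rightarrow> {..<4}"
    by (auto simp: c_def)
  ultimately show ?thesis
    unfolding colorable_def by blast
qed

theorem corollary2p4:
  fixes G :: "'a ugraph" and T :: "('a + 'a set) signed_graph"
  assumes "simple_graph G"
    and "is_T2 (G, all_positive) T"
  shows "colorable 4 G \<longleftrightarrow> admits_hom T C_minus_4"
  using assms hom_C_minus_4_if_colorable colorable_if_hom_C_minus_4 by (metis prod.collapse)

end
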